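(* For every integer $n\ge 1$ and every $\varepsilon\in\{+,-\}^{n-1}$, $$\sum_{\pi\in S_n} t^{\operatorname{rec}_\varepsilon(\pi)} = n!\,\Omega(P_\varepsilon;t)$$ as polynomials in $t$.
   Context: Fence: for $\varepsilon=(\varepsilon_1,\ldots,\varepsilon_{n-1})\in\{+,-\}^{n-1}$, $P_\varepsilon$ is the poset on $\{x_1,\ldots,x_n\}$ obtained as the transitive closure of the relations $x_i\succ x_{i+1}$ if $\varepsilon_i=+$, and $x_i\prec x_{i+1}$ if $\varepsilon_i=-$, for $1\le i\le n-1$. Order polynomial: for a finite poset $P$, $\Omega(P;t)$ is the polynomial with $\Omega(P;m)=\#\{f:P\to[m]\text{ order-preserving}\}$ for all positive integers $m$, where $[m]=\{1,\ldots,m\}$ and order-preserving is in the weak sense ($a\preceq b\Rightarrow f(a)\le f(b)$). Greedy records: for $\pi=\pi_1\cdots\pi_n\in S_n$, construct positions $i_0>i_1>\cdots>i_s$ as follows. Set $i_0=n$. Once $i_j$ is chosen, let $A_j(\pi)$ be the set of $i<i_j$ such that $\pi_i>\pi_{i_j}$ if $\varepsilon_i=+$, and $\pi_i<\pi_{i_j}$ if $\varepsilon_i=-$. If $A_j(\pi)=\varnothing$, stop; otherwise set $i_{j+1}=\max A_j(\pi)$. Put $\operatorname{Rec}_\varepsilon(\pi)=\{i_0,\ldots,i_s\}$ and $\operatorname{rec}_\varepsilon(\pi)=|\operatorname{Rec}_\varepsilon(\pi)|=s+1$. *)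

theory Defs
  imports
    "HOL-Library.FuncSet"
    "HOL-Library.Infinite_Set"
    "HOL-Combinatorics.Permutations"
    "HOL-Computational_Algebra.Polynomial"
begin

datatype plusminus = Plus | Minus

text \<open>
  A sign vector \<open>\<epsilon> \<in> {+,-}\<^sup>n\<^sup>-\<^sup>1\<close> is a function \<open>\<epsilon> :: nat \<Rightarrow> plusminus\<close> of which only the values
  at \<open>1, \<dots>, n - 1\<close> are ever inspected. The element \<open>x\<^sub>i\<close> of the fence is the index \<open>i\<close>.
  A pair \<open>(a, b)\<close> in a relation means that \<open>a\<close> lies below \<open>b\<close>.
\<close>

definition fence_step :: "nat \<Rightarrow> (nat \<Rightarrow> plusminus) \<Rightarrow> nat rel" where
  "fence_step n \<epsilon> =
     {(Suc i, i) | i. 1 \<le> i \<and> i \<le> n - 1 \<and> \<epsilon> i = Plus} \<union>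
     {(i, Suc i) | i. 1 \<le> i \<and> i \<le> n - 1 \<and> \<epsilon> i = Minus}"

text \<open>
  The transitive closure is the strict order of the fence; the weak order adds the diagonal
  of the ground set.
\<close>

definition fence :: "nat \<Rightarrow> (nat \<Rightarrow> plusminus) \<Rightarrow> nat rel" where
  "fence n \<epsilon> = Id_on {1..n} \<union> (fence_step n \<epsilon>)\<^sup>+"

lemma fence_step_trancl_subset:
  "(fence_step n \<epsilon>)\<^sup>+ \<subseteq>
     {(a, b). 1 \<le> a \<and> a < b \<and> b \<le> n \<and> (\<forall>i. a \<le> i \<and> i < b \<longrightarrow> \<epsilon> i = Minus)} \<union>
     {(a, b). 1 \<le> b \<and> b < a \<and> a \<le> n \<and> (\<forall>i. b \<le> i \<and> i < a \<longrightarrow> \<epsilon> i = Plus)}"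
  (is "_ \<subseteq> ?U \<union> ?D")
proof -
  have "(a, c) \<in> ?U \<union> ?D" if "(a, c) \<in> (fence_step n \<epsilon>)\<^sup>+" for a c
    using that
  proof (induction rule: trancl_induct)
    case (base c)
    then show ?case by (auto simp: fence_step_def less_Suc_eq_le dest: antisym)
  next
    case (step b c)
    consider "(a, b) \<in> ?U" | "(a, b) \<in> ?D" using step.IH by blast
    then show ?case
    proof cases
      case 1
      then have "\<epsilon> (b - 1) = Minus" "a < b" by auto
      then have "c = Suc b \<and> 1 \<le> b \<and> c \<le> n \<and> \<epsilon> b = Minus"
        using step(2) by (auto simp: fence_step_def)
      then show ?thesis using 1 by (auto simp: less_Suc_eq)
    next
      case 2
      then have "\<epsilon> b = Plus" "b < a" by auto
      then have "b = Suc c \<and> 1 \<le> c \<and> b \<le> n \<and> \<epsilon> c = Plus"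
        using step(2) by (auto simp: fence_step_def)
      then show ?thesis using 2 by (auto simp: Suc_le_eq) (metis Suc_leI le_neq_implies_less)
    qed
  qed
  then show ?thesis by auto
qed

lemma partial_order_on_fence: "partial_order_on {1..n} (fence n \<epsilon>)"
proof -
  note sub = fence_step_trancl_subset[of n \<epsilon>]
  have tr: "trans (fence n \<epsilon>)"
    unfolding fence_def
  proof (rule transI)
    fix a b c
    assume "(a, b) \<in> Id_on {1..n} \<union> (fence_step n \<epsilon>)\<^sup>+"
      and "(b, c) \<in> Id_on {1..n} \<union> (fence_step n \<epsilon>)\<^sup>+"
    then show "(a, c) \<in> Id_on {1..n} \<union> (fence_step n \<epsilon>)\<^sup>+"
      using trancl_trans[of a b "fence_step n \<epsilon>" c] by (elim UnE Id_onE) (simp_all add: Id_on_iff)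
  qed
  have an: "antisym (fence n \<epsilon>)"
  proof (rule antisymI)
    fix a b assume "(a, b) \<in> fence n \<epsilon>" "(b, a) \<in> fence n \<epsilon>"
    then consider "a = b" | "(a, b) \<in> (fence_step n \<epsilon>)\<^sup>+" "(b, a) \<in> (fence_step n \<epsilon>)\<^sup>+"
      unfolding fence_def by auto
    then show "a = b"
    proof cases
      case 2
      from subsetD[OF sub 2(1)] subsetD[OF sub 2(2)] show ?thesis
        by fastforce
    qed
  qed
  have "fence n \<epsilon> \<subseteq> {1..n} \<times> {1..n}"
    using sub unfolding fence_def by fastforce
  moreover have "refl_on {1..n} (fence n \<epsilon>)"
    unfolding fence_def refl_on_def by auto
  ultimately show ?thesis
    using tr an unfolding partial_order_on_def preorder_on_def by auto
qed

text \<open>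
  A poset is given by its ground set \<open>A\<close> and its weak order \<open>r\<close>. Maps are extensional
  (undefined outside \<open>A\<close>) so that counting them is counting functions on \<open>A\<close>.
\<close>

definition order_preserving_maps :: "'a set \<Rightarrow> 'a rel \<Rightarrow> nat \<Rightarrow> ('a \<Rightarrow> nat) set" where
  "order_preserving_maps A r m =
     {f \<in> A \<rightarrow>\<^sub>E {1..m}. \<forall>a\<in>A. \<forall>b\<in>A. (a, b) \<in> r \<longrightarrow> f a \<le> f b}"

definition order_polynomial :: "'a set \<Rightarrow> 'a rel \<Rightarrow> rat poly" where
  "order_polynomial A r =
     (THE p. \<forall>m\<ge>1. poly p (of_nat m) = of_nat (card (order_preserving_maps A r m)))"

text \<open>For finite \<open>A\<close> such a polynomial exists and is unique.\<close>

lemma poly_eqI_of_nat: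
  fixes p q :: "rat poly"
  assumes "\<And>m. m \<ge> 1 \<Longrightarrow> poly p (of_nat m) = poly q (of_nat m)"
  shows "p = q"
proof (rule ccontr)
  assume "p \<noteq> q"
  then have "finite {x. poly (p - q) x = 0}" by (intro poly_roots_finite) auto
  moreover have "of_nat ` {1..} \<subseteq> {x. poly (p - q) x = (0 :: rat)}" using assms by auto
  ultimately have "finite ((of_nat :: nat \<Rightarrow> rat) ` {1..})" by (rule finite_subset[rotated])
  then have "finite {1::nat..}" by (rule finite_imageD) (auto simp: inj_on_def)
  then show False using infinite_Ici by blast
qed

lemma order_polynomial_exists:
  assumes fin: "finite A"
  shows "\<exists>p :: rat poly. \<forall>m. poly p (of_nat m) = of_nat (card (order_preserving_maps A r m))"
proof -
  define mono_onto :: "nat set \<Rightarrow> ('a \<Rightarrow> nat) set" where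
    "mono_onto S = {f \<in> A \<rightarrow>\<^sub>E S. f ` A = S \<and> (\<forall>a\<in>A. \<forall>b\<in>A. (a, b) \<in> r \<longrightarrow> f a \<le> f b)}" for S
  define e where "e k = card (mono_onto {..<k})" for k
  have fin_onto: "finite (mono_onto S)" if "finite S" for S
    by (rule finite_subset[of _ "A \<rightarrow>\<^sub>E S"]) (use that fin in \<open>auto simp: mono_onto_def intro: finite_PiE\<close>)
  have e: "card (mono_onto S) = e (card S)" if S: "finite S" for S
  proof -
    let ?K = "{..<card S}"
    obtain h where h: "bij_betw h ?K S" "strict_mono_on ?K h"
      using ex_bij_betw_strict_mono_card[OF S] by blast
    have le: "h x \<le> h y \<longleftrightarrow> x \<le> y" if "x \<in> ?K" "y \<in> ?K" for x y
      using strict_mono_on_less_eq[OF h(2)] that by blast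
    let ?g = "the_inv_into ?K h"
    have inj: "inj_on h ?K" and im: "h ` ?K = S" using h(1) by (auto simp: bij_betw_def)
    have hg: "h (?g y) = y" and gK: "?g y \<in> ?K" if "y \<in> S" for y
      using f_the_inv_into_f[OF inj] the_inv_into_into[OF inj _ order_refl] that im by auto
    have gh: "?g (h x) = x" if "x \<in> ?K" for x
      using the_inv_into_f_f[OF inj that] .
    have gim: "?g ` S = ?K"
      using hg gK gh im by (auto simp: image_iff) (metis im imageI lessThan_iff)
    have "bij_betw (\<lambda>f. restrict (\<lambda>a. h (f a)) A) (mono_onto ?K) (mono_onto S)"
    proof (rule bij_betwI[where g = "\<lambda>f. restrict (\<lambda>a. ?g (f a)) A"])
      show "(\<lambda>f. restrict (\<lambda>a. h (f a)) A) \<in> mono_onto ?K \<rightarrow> mono_onto S"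
      proof
        fix f assume f: "f \<in> mono_onto ?K"
        then have fa: "f a \<in> ?K" if "a \<in> A" for a using that by (auto simp: mono_onto_def)
        have "(\<lambda>a. h (f a)) ` A = S"
          using f im by (simp add: mono_onto_def image_image[symmetric])
        then show "restrict (\<lambda>a. h (f a)) A \<in> mono_onto S"
          using f fa le unfolding mono_onto_def by (auto cong: image_cong)
      qed
      show "(\<lambda>f. restrict (\<lambda>a. ?g (f a)) A) \<in> mono_onto S \<rightarrow> mono_onto ?K"
      proof
        fix f assume f: "f \<in> mono_onto S"
        then have fa: "f a \<in> S" if "a \<in> A" for a using that by (auto simp: mono_onto_def)
        have "(\<lambda>a. ?g (f a)) ` A = ?K"
          using f gim by (simp add: mono_onto_def image_image[symmetric])
        moreover have "?g (f a) \<le> ?g (f b)" if "a \<in> A" "b \<in> A" "(a, b) \<in> r" for a b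
          using le[OF gK gK, of "f a" "f b"] hg fa that f by (auto simp: mono_onto_def)
        ultimately show "restrict (\<lambda>a. ?g (f a)) A \<in> mono_onto ?K"
          using gK fa unfolding mono_onto_def by (auto cong: image_cong)
      qed
      show "restrict (\<lambda>a. ?g (restrict (\<lambda>a. h (f a)) A a)) A = f" if f: "f \<in> mono_onto ?K" for f
      proof (rule ext)
        fix a show "restrict (\<lambda>a. ?g (restrict (\<lambda>a. h (f a)) A a)) A a = f a"
          using f gh by (cases "a \<in> A") (auto simp: mono_onto_def PiE_iff extensional_def)
      qed
      show "restrict (\<lambda>a. h (restrict (\<lambda>a. ?g (f a)) A a)) A = f" if f: "f \<in> mono_onto S" for f
      proof (rule ext)
        fix a show "restrict (\<lambda>a. h (restrict (\<lambda>a. ?g (f a)) A a)) A a = f a"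
          using f hg by (cases "a \<in> A") (auto simp: mono_onto_def PiE_iff extensional_def)
      qed
    qed
    then show ?thesis unfolding e_def by (simp add: bij_betw_same_card)
  qed
  have e0: "e k = 0" if "k > card A" for k
  proof -
    have "mono_onto {..<k} = {}"
    proof (rule ccontr)
      assume "mono_onto {..<k} \<noteq> {}"
      then obtain f where "f ` A = {..<k}" by (auto simp: mono_onto_def)
      then have "k \<le> card A" using card_image_le[OF fin, of f] by simp
      then show False using that by simp
    qed
    then show ?thesis by (simp add: e_def)
  qed
  have count: "card (order_preserving_maps A r m) = (\<Sum>k\<le>card A. e k * (m choose k))" for m
  proof -
    have "order_preserving_maps A r m = (\<Union>S\<in>Pow {1..m}. mono_onto S)"
      unfolding order_preserving_maps_def mono_onto_def by (auto simp: PiE_iff)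
    moreover have "card (\<Union>S\<in>Pow {1..m}. mono_onto S) = (\<Sum>S\<in>Pow {1..m}. card (mono_onto S))"
    proof (rule card_UN_disjoint)
      show "\<forall>S\<in>Pow {1..m}. finite (mono_onto S)"
        using fin_onto finite_subset[OF _ finite_atLeastAtMost] by blast
    qed (auto simp: mono_onto_def)
    moreover have "(\<Sum>S\<in>Pow {1..m}. card (mono_onto S)) = (\<Sum>S\<in>Pow {1..m}. e (card S))"
      by (rule sum.cong) (auto intro!: e finite_subset[of _ "{1..m}"])
    moreover have "\<dots> = (\<Sum>k\<le>m. \<Sum>S\<in>{S \<in> Pow {1..m}. card S = k}. e (card S))"
    proof (rule sum.group[symmetric])
      show "card ` Pow {1..m} \<subseteq> {..m}"
        using card_mono[of "{1..m}"] by fastforce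
    qed auto
    moreover have "\<dots> = (\<Sum>k\<le>m. e k * (m choose k))"
    proof (rule sum.cong[OF refl])
      fix k
      have "card {S \<in> Pow {1..m}. card S = k} = m choose k"
        using n_subsets[of "{1..m}" k] by (simp add: Pow_def)
      then show "(\<Sum>S\<in>{S \<in> Pow {1..m}. card S = k}. e (card S)) = e k * (m choose k)"
        by simp
    qed
    moreover have "\<dots> = (\<Sum>k\<le>max m (card A). e k * (m choose k))"
      by (rule sum.mono_neutral_left) (auto simp: binomial_eq_0)
    moreover have "\<dots> = (\<Sum>k\<le>card A. e k * (m choose k))"
      by (rule sum.mono_neutral_right) (auto simp: e0)
    ultimately show ?thesis by simp
  qed
  define B :: "nat \<Rightarrow> rat poly" where
    "B k = smult (1 / fact k) (\<Prod>i<k. [:- of_nat i, 1:])" for k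
  have B: "poly (B k) (of_nat m) = of_nat (m choose k)" for k m
    unfolding binomial_gbinomial gbinomial_prod_rev B_def
    by (simp add: poly_prod atLeast0LessThan)
  have "poly (\<Sum>k\<le>card A. smult (of_nat (e k)) (B k)) (of_nat m) =
      of_nat (card (order_preserving_maps A r m))" for m
    by (simp add: poly_sum B count)
  then show ?thesis by blast
qed

lemma poly_order_polynomial:
  assumes "finite A" "m \<ge> 1"
  shows "poly (order_polynomial A r) (of_nat m) = of_nat (card (order_preserving_maps A r m))"
proof -
  have "\<exists>!p :: rat poly. \<forall>m\<ge>1. poly p (of_nat m) = of_nat (card (order_preserving_maps A r m))"
    using order_polynomial_exists[OF assms(1), of r] poly_eqI_of_nat by (metis (no_types, lifting))
  from theI'[OF this] assms(2) show ?thesis unfolding order_polynomial_def by blast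
qed

text \<open>
  \<open>candidates \<epsilon> \<pi> p\<close> is the set \<open>A\<^sub>j(\<pi>)\<close> when \<open>p = i\<^sub>j\<close> is the current position, and
  \<open>records_from \<epsilon> \<pi> p\<close> is the set of all positions visited from \<open>p\<close> on. Permutations are in
  one-line notation, \<open>\<pi>\<^sub>i = \<pi> i\<close>.
\<close>

definition candidates :: "(nat \<Rightarrow> plusminus) \<Rightarrow> (nat \<Rightarrow> nat) \<Rightarrow> nat \<Rightarrow> nat set" where
  "candidates \<epsilon> \<pi> p =
     {i. 1 \<le> i \<and> i < p \<and> (case \<epsilon> i of Plus \<Rightarrow> \<pi> i > \<pi> p | Minus \<Rightarrow> \<pi> i < \<pi> p)}"

lemma finite_candidates: "finite (candidates \<epsilon> \<pi> p)"
  by (simp add: candidates_def)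

function records_from :: "(nat \<Rightarrow> plusminus) \<Rightarrow> (nat \<Rightarrow> nat) \<Rightarrow> nat \<Rightarrow> nat set" where
  "records_from \<epsilon> \<pi> p =
     (if candidates \<epsilon> \<pi> p = {} then {p}
      else insert p (records_from \<epsilon> \<pi> (Max (candidates \<epsilon> \<pi> p))))"
  by auto
termination
proof (relation "measure (\<lambda>(\<epsilon>, \<pi>, p). p)")
  fix \<epsilon> \<pi> p assume "candidates \<epsilon> \<pi> p \<noteq> {}"
  then have "Max (candidates \<epsilon> \<pi> p) \<in> candidates \<epsilon> \<pi> p"
    by (intro Max_in finite_candidates)
  then show "((\<epsilon>, \<pi>, Max (candidates \<epsilon> \<pi> p)), (\<epsilon>, \<pi>, p)) \<in> measure (\<lambda>(\<epsilon>, \<pi>, p). p)"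
    by (simp add: candidates_def)
qed auto

declare records_from.simps [simp del]

definition Rec :: "nat \<Rightarrow> (nat \<Rightarrow> plusminus) \<Rightarrow> (nat \<Rightarrow> nat) \<Rightarrow> nat set" where
  "Rec n \<epsilon> \<pi> = records_from \<epsilon> \<pi> n"

definition rec_count :: "nat \<Rightarrow> (nat \<Rightarrow> plusminus) \<Rightarrow> (nat \<Rightarrow> nat) \<Rightarrow> nat" where
  "rec_count n \<epsilon> \<pi> = card (Rec n \<epsilon> \<pi>)"

end

theory Submission
  imports Defs "HOL-Combinatorics.Multiset_Permutations"
begin

text \<open>
  Both sides are polynomials in \<open>t\<close>, so it suffices to compare them at the integers \<open>t = m \<ge> n\<close>.
  At such an \<open>m\<close> both sides are governed by a recursion along the positions \<open>1, \<dots>, n\<close>, and the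
  point is that the two recursions agree after a change of degree of Bernstein polynomials.

  The continuous picture explains this. Let the entries \<open>u\<^sub>i\<close> of the word be independent
  and uniform on \<open>[0,1]\<close>, and let \<open>G\<^sub>k(x)\<close> be the expectation of \<open>t\<close> to the number of moves that
  the greedy walk makes inside the positions \<open>1, \<dots>, k\<close> when its current value is \<open>x\<close>. If
  \<open>\<epsilon>\<^sub>k = +\<close>, then either \<open>u\<^sub>k < x\<close> and position \<open>k\<close> is skipped, or the walk moves to \<open>k\<close>:
  \<open>G\<^sub>k(x) = x G\<^sub>k\<^sub>-\<^sub>1(x) + t \<integral>\<^sub>x\<^sup>1 G\<^sub>k\<^sub>-\<^sub>1(y) dy\<close>. Put \<open>t = m\<close> and expand in the Bernstein basis
  \<open>B\<^sub>a(x) = (m - 1 choose a) x\<^sup>a (1 - x)\<^sup>m\<^sup>-\<^sup>1\<^sup>-\<^sup>a\<close>. As \<open>m \<integral>\<^sub>x\<^sup>1 B\<^sub>a\<close> is the probability that a binomial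
  variable with parameters \<open>m\<close> and \<open>x\<close> is at most \<open>a\<close>, and as \<open>B\<^sub>0 + \<dots> + B\<^sub>a\<close> is the same probability
  after only \<open>m - 1\<close> of the \<open>m\<close> trials, the two differ by \<open>x B\<^sub>a\<close>. Hence the recursion sends \<open>B\<^sub>a\<close> to
  \<open>B\<^sub>0 + \<dots> + B\<^sub>a\<close>. It replaces a sequence of coefficients by its upper sums, which is exactly how the
  number of order-preserving maps of \<open>x\<^sub>1, \<dots>, x\<^sub>k\<^sub>+\<^sub>1\<close> with a prescribed value at \<open>x\<^sub>k\<^sub>+\<^sub>1\<close> evolves
  with \<open>k\<close>. The case \<open>\<epsilon>\<^sub>k = -\<close> is symmetric.

  The proof below is a discrete form of this computation. Instead of \<open>G\<^sub>k\<close> it keeps the number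
  \<open>walk_sum t \<epsilon> k N a\<close>, which is up to a factorial the \<open>a\<close>-th Bernstein coefficient of \<open>G\<^sub>k\<close> in
  degree \<open>N\<close>, and passes from degree \<open>N\<close> to degree \<open>N + 1\<close> by the operator \<open>elevate\<close>.
  Degree \<open>N = k\<close> is where permutations are counted (\<open>walk_sum_counts_words\<close>), degree
  \<open>N = m - 1\<close> is where maps into \<open>[m]\<close> are counted (\<open>walk_sum_eq_fence_count\<close>), and the two are
  linked because the recursion commutes with \<open>elevate\<close> (\<open>walk_sum_elevate\<close>). The last step of the
  walk, the integral of \<open>G\<^sub>n\<^sub>-\<^sub>1\<close> over \<open>[0,1]\<close>, becomes a sum over all \<open>a\<close> (\<open>sum_walk_sum\<close>).
\<close>

section \<open>Counting by rank\<close>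

lemma bij_betw_filter:
  assumes "bij_betw f A B"
  shows "bij_betw f {x. x \<in> A \<and> P (f x)} {y. y \<in> B \<and> P y}"
  using assms by (auto simp: bij_betw_def inj_on_def)

text \<open>
  The number of words over an alphabet depends only on the relative order of the letters, so
  letters are replaced by their ranks. This avoids relabelling an alphabet after a letter has been
  removed from it.
\<close>

lemma bij_betw_rank:
  fixes V :: "nat set"
  assumes "finite V"
  shows "bij_betw (\<lambda>y. card {v \<in> V. v < y}) V {..<card V}"
proof -
  let ?rank = "\<lambda>y. card {v \<in> V. v < y}"
  have less: "?rank x < ?rank y" if "x \<in> V" "x < y" for x y
    by (rule psubset_card_mono) (use that assms in auto)
  have inj: "inj_on ?rank V"
    by (rule linorder_inj_onI) (use less in fastforce)+
  have "?rank ` V \<subseteq> {..<card V}"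
    using assms by (auto intro!: psubset_card_mono)
  moreover have "card (?rank ` V) = card {..<card V}"
    using card_image[OF inj] by simp
  ultimately show ?thesis
    using inj by (simp add: bij_betw_def card_subset_eq)
qed

lemma sum_over_ranks:
  fixes V :: "nat set"
  assumes "finite V"
  shows "(\<Sum>y\<in>V. h (card {v \<in> V. v < y})) = (\<Sum>s<card V. h s)"
  using sum.reindex_bij_betw[OF bij_betw_rank[OF assms], of h] .

lemma
  fixes V :: "nat set"
  assumes fin: "finite V" and x: "x \<notin> V"
  defines "a \<equiv> card {v \<in> V. v < x}"
  shows sum_over_ranks_above:
      "(\<Sum>y | y \<in> V \<and> x < y. h (card {v \<in> V. v < y})) = (\<Sum>s=a..<card V. h s)" (is ?above)
    and sum_over_ranks_below:
      "(\<Sum>y | y \<in> V \<and> y < x. h (card {v \<in> V. v < y})) = (\<Sum>s<a. h s)" (is ?below)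
proof -
  let ?rank = "\<lambda>y. card {v \<in> V. v < y}"
  have up: "a \<le> ?rank y" if "x < y" for y
    unfolding a_def by (rule card_mono) (use that fin in auto)
  have down: "?rank y < a" if "y \<in> V" "y < x" for y
    unfolding a_def by (rule psubset_card_mono) (use that fin in auto)
  have side: "x < y \<longleftrightarrow> a \<le> ?rank y" if "y \<in> V" for y
    using up[of y] down[OF that] x that by (metis linorder_neqE_nat not_le)
  have "a \<le> card V"
    unfolding a_def by (rule card_mono) (use fin in auto)
  then have cut: "{s. s \<in> {..<card V} \<and> a \<le> s} = {a..<card V}"
      "{s. s \<in> {..<card V} \<and> s < a} = {..<a}"
    by auto
  have restrict: "bij_betw ?rank {y. y \<in> V \<and> P (?rank y)} {s. s \<in> {..<card V} \<and> P s}" for P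
    using bij_betw_rank[OF fin] by (rule bij_betw_filter)
  have "{y. y \<in> V \<and> x < y} = {y. y \<in> V \<and> a \<le> ?rank y}"
    by (intro Collect_cong conj_cong refl side)
  then have "bij_betw ?rank {y. y \<in> V \<and> x < y} {a..<card V}"
    using restrict[of "\<lambda>s. a \<le> s"] by (simp only: cut)
  then show ?above by (rule sum.reindex_bij_betw)
  have "y < x \<longleftrightarrow> ?rank y < a" if "y \<in> V" for y
  proof -
    have "y \<noteq> x" using that x by auto
    then show ?thesis using side[OF that] by linarith
  qed
  then have "{y. y \<in> V \<and> y < x} = {y. y \<in> V \<and> ?rank y < a}"
    by (intro Collect_cong conj_cong refl)
  then have "bij_betw ?rank {y. y \<in> V \<and> y < x} {..<a}"
    using restrict[of "\<lambda>s. s < a"] by (simp only: cut)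
  then show ?below by (rule sum.reindex_bij_betw)
qed

section \<open>Greedy records of words\<close>

text \<open>
  The strict comparison that the sign at a position imposes between the entry \<open>y\<close> there and
  the value \<open>x\<close> it is compared with: the walk moves from \<open>x\<close> to \<open>y\<close>. The weak version of the same
  comparison is the local condition on a map of the fence.
\<close>

definition on_side :: "plusminus \<Rightarrow> nat \<Rightarrow> nat \<Rightarrow> bool" where
  "on_side s y x = (case s of Plus \<Rightarrow> x < y | Minus \<Rightarrow> y < x)"

text \<open>
  The number of moves of the greedy walk whose current value is \<open>x\<close>. Words are read from
  right to left, so that the head of the list is the next entry to be inspected and the length of
  the list is its position.
\<close>

fun steps :: "(nat \<Rightarrow> plusminus) \<Rightarrow> nat \<Rightarrow> nat list \<Rightarrow> nat" where
  "steps \<epsilon> x [] = 0"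
| "steps \<epsilon> x (y # ys) =
     (if on_side (\<epsilon> (Suc (length ys))) y x then Suc (steps \<epsilon> y ys) else steps \<epsilon> x ys)"

definition down_word :: "(nat \<Rightarrow> nat) \<Rightarrow> nat \<Rightarrow> nat list" where
  "down_word \<pi> q = map \<pi> (rev [1..<Suc q])"

lemma down_word_simps [simp]:
  "down_word \<pi> 0 = []"
  "down_word \<pi> (Suc q) = \<pi> (Suc q) # down_word \<pi> q"
  "length (down_word \<pi> q) = q"
  by (simp_all add: down_word_def)

lemma candidates_iff: "i \<in> candidates \<epsilon> \<pi> p \<longleftrightarrow> 1 \<le> i \<and> i < p \<and> on_side (\<epsilon> i) (\<pi> i) (\<pi> p)"
  by (auto simp: candidates_def on_side_def split: plusminus.split)

lemma records_from_subset: "records_from \<epsilon> \<pi> p \<subseteq> {..p}"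
proof (induction p rule: less_induct)
  case (less p)
  show ?case
  proof (cases "candidates \<epsilon> \<pi> p = {}")
    case False
    then have "Max (candidates \<epsilon> \<pi> p) < p"
      using Max_in[OF finite_candidates False] by (simp add: candidates_iff)
    then have "records_from \<epsilon> \<pi> (Max (candidates \<epsilon> \<pi> p)) \<subseteq> {..p}"
      using less[of "Max (candidates \<epsilon> \<pi> p)"] by (auto intro: less_imp_le)
    then show ?thesis
      using False by (subst records_from.simps) simp
  qed (simp add: records_from.simps)
qed

text \<open>
  The walk of \<open>records_from\<close> jumps to the largest candidate, whereas \<open>steps\<close> inspects one
  position at a time. The generalisation to a bound \<open>q\<close> describes the intermediate states, in
  which the positions strictly between \<open>q\<close> and \<open>p\<close> have been inspected in vain.
\<close>

lemma card_records_from_no_candidates_above: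
  assumes "q < p" and "\<And>i. i \<in> candidates \<epsilon> \<pi> p \<Longrightarrow> i \<le> q"
  shows "card (records_from \<epsilon> \<pi> p) = Suc (steps \<epsilon> (\<pi> p) (down_word \<pi> q))"
  using assms
proof (induction q arbitrary: p)
  case 0
  then have "candidates \<epsilon> \<pi> p = {}" by (force simp: candidates_iff)
  then show ?case by (simp add: records_from.simps)
next
  case (Suc q)
  show ?case
  proof (cases "on_side (\<epsilon> (Suc q)) (\<pi> (Suc q)) (\<pi> p)")
    case True
    then have cand: "Suc q \<in> candidates \<epsilon> \<pi> p"
      using Suc.prems by (simp add: candidates_iff)
    then have "Max (candidates \<epsilon> \<pi> p) = Suc q"
      using Suc.prems by (intro Max_eqI finite_candidates) auto
    then have "records_from \<epsilon> \<pi> p = insert p (records_from \<epsilon> \<pi> (Suc q))"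
      using cand by (subst records_from.simps) auto
    moreover have "p \<notin> records_from \<epsilon> \<pi> (Suc q)" "finite (records_from \<epsilon> \<pi> (Suc q))"
      using records_from_subset[of \<epsilon> \<pi> "Suc q"] Suc.prems finite_subset by auto
    moreover have "card (records_from \<epsilon> \<pi> (Suc q))
        = Suc (steps \<epsilon> (\<pi> (Suc q)) (down_word \<pi> q))"
      by (rule Suc.IH) (auto simp: candidates_iff)
    ultimately show ?thesis using True by simp
  next
    case False
    have "card (records_from \<epsilon> \<pi> p) = Suc (steps \<epsilon> (\<pi> p) (down_word \<pi> q))"
    proof (rule Suc.IH)
      fix i assume "i \<in> candidates \<epsilon> \<pi> p"
      then show "i \<le> q" using Suc.prems(2)[of i] False by (cases "i = Suc q") (auto simp: candidates_iff)
    qed (use Suc.prems in simp)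
    then show ?thesis using False by simp
  qed
qed

lemma rec_count_eq_steps: "rec_count (Suc k) \<epsilon> \<pi> = Suc (steps \<epsilon> (\<pi> (Suc k)) (down_word \<pi> k))"
  unfolding rec_count_def Rec_def
  by (rule card_records_from_no_candidates_above) (auto simp: candidates_iff)

lemma bij_betw_down_word:
  "bij_betw (\<lambda>\<pi>. down_word \<pi> n) {\<pi>. \<pi> permutes {1..n}} (permutations_of_set {1..n})"
proof -
  have inj: "inj_on (\<lambda>\<pi>. down_word \<pi> n) {\<pi>. \<pi> permutes {1..n}}"
  proof (rule inj_onI; rule ext)
    fix \<pi> \<sigma> i
    assume \<pi>: "\<pi> \<in> {\<pi>. \<pi> permutes {1..n}}" and \<sigma>: "\<sigma> \<in> {\<pi>. \<pi> permutes {1..n}}"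
      and eq: "down_word \<pi> n = down_word \<sigma> n"
    show "\<pi> i = \<sigma> i"
    proof (cases "i \<in> {1..n}")
      case True
      have "\<forall>j\<in>set (rev [1..<Suc n]). \<pi> j = \<sigma> j"
        using eq unfolding down_word_def by (simp only: map_eq_conv)
      then show ?thesis using True by (simp del: upt_Suc)
    next
      case False
      then show ?thesis using \<pi> \<sigma> by (simp add: permutes_not_in del: atLeastAtMost_iff)
    qed
  qed
  have "down_word \<pi> n \<in> permutations_of_set {1..n}" if "\<pi> permutes {1..n}" for \<pi>
  proof
    show "set (down_word \<pi> n) = {1..n}"
      using permutes_image[OF that] by (simp add: down_word_def atLeastLessThanSuc_atLeastAtMost del: upt_Suc)
    show "distinct (down_word \<pi> n)"
      using permutes_inj_on[OF that] by (simp add: down_word_def distinct_map)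
  qed
  then have "(\<lambda>\<pi>. down_word \<pi> n) ` {\<pi>. \<pi> permutes {1..n}} \<subseteq> permutations_of_set {1..n}" by auto
  moreover have "card ((\<lambda>\<pi>. down_word \<pi> n) ` {\<pi>. \<pi> permutes {1..n}})
      = card (permutations_of_set {1..n})"
    using card_image[OF inj] card_permutations[of "{1..n}" n] by simp
  ultimately show ?thesis using inj by (simp add: bij_betw_def card_subset_eq)
qed

lemma sum_permutations_of_set_first:
  fixes g :: "'a list \<Rightarrow> nat"
  assumes "finite V" "V \<noteq> {}"
  shows "(\<Sum>xs\<in>permutations_of_set V. g xs)
    = (\<Sum>y\<in>V. \<Sum>ys\<in>permutations_of_set (V - {y}). g (y # ys))"
proof -
  have "(\<Sum>xs\<in>permutations_of_set V. g xs)
      = (\<Sum>y\<in>V. \<Sum>xs\<in>(#) y ` permutations_of_set (V - {y}). g xs)"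
    unfolding permutations_of_set_nonempty[OF assms(2)]
    by (rule sum.UNION_disjoint) (use assms in auto)
  then show ?thesis by (simp add: sum.reindex)
qed

section \<open>The record recursion\<close>

text \<open>
  For \<open>k \<le> N\<close> and \<open>a \<le> N\<close> this is the sum of \<open>t\<close> to the number of moves, over all words that
  use each letter of \<open>{0..N}\<close> except \<open>a\<close> once, of the walk that starts with current value \<open>a\<close> and
  inspects the positions \<open>k, \<dots>, 1\<close>. The other \<open>N - k\<close> positions are never looked at, whence the
  factorial for \<open>k = 0\<close>. In the recursion the letter at position \<open>k\<close> is removed from the alphabet: if
  it is skipped, the current value stays and its rank drops by one when the removed letter was
  smaller; if it is hit, it becomes the current value and the old value disappears, so the rank
  \<open>s\<close> of the new one is counted without the old one.
\<close>

primrec walk_sum :: "nat \<Rightarrow> (nat \<Rightarrow> plusminus) \<Rightarrow> nat \<Rightarrow> nat \<Rightarrow> nat \<Rightarrow> nat" where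
  "walk_sum t \<epsilon> 0 N a = fact N"
| "walk_sum t \<epsilon> (Suc k) N a =
     (case \<epsilon> (Suc k) of
       Plus \<Rightarrow> a * walk_sum t \<epsilon> k (N - 1) (a - 1) + t * (\<Sum>s=a..<N. walk_sum t \<epsilon> k (N - 1) s)
     | Minus \<Rightarrow> (N - a) * walk_sum t \<epsilon> k (N - 1) a + t * (\<Sum>s<a. walk_sum t \<epsilon> k (N - 1) s))"

text \<open>
  Every word over \<open>V\<close> is split into its entry \<open>y\<close> at the last position and a word over
  \<open>V - {y}\<close>, on which the walk continues either from \<open>x\<close> or from \<open>y\<close>.
\<close>

lemma walk_sum_counts_words:
  assumes "finite V" "card V = k" "x \<notin> V"
  shows "(\<Sum>xs\<in>permutations_of_set V. t ^ steps \<epsilon> x xs)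
    = walk_sum t \<epsilon> k k (card {v \<in> V. v < x})"
  using assms
proof (induction k arbitrary: V x)
  case 0
  then show ?case by simp
next
  case (Suc k)
  let ?rank = "\<lambda>y. card {v \<in> V. v < y}"
  let ?W = "walk_sum t \<epsilon> k k"
  let ?hit = "\<lambda>y. on_side (\<epsilon> (Suc k)) y x"
  have len: "length ys = k" if "y \<in> V" "ys \<in> permutations_of_set (V - {y})" for y ys
    using length_finite_permutations_of_set[OF that(2)] that Suc.prems by simp
  have card_del: "card (V - {y}) = k" if "y \<in> V" for y
    using that Suc.prems by simp
  have "(\<Sum>xs\<in>permutations_of_set V. t ^ steps \<epsilon> x xs)
      = (\<Sum>y\<in>V. \<Sum>ys\<in>permutations_of_set (V - {y}). t ^ steps \<epsilon> x (y # ys))"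
    by (rule sum_permutations_of_set_first) (use Suc.prems in auto)
  also have "\<dots> = (\<Sum>y\<in>V. if ?hit y then t * ?W (?rank y) else ?W (card {v \<in> V - {y}. v < x}))"
  proof (rule sum.cong[OF refl])
    fix y assume y: "y \<in> V"
    have same: "{v \<in> V - {y}. v < y} = {v \<in> V. v < y}" by auto
    have "(\<Sum>ys\<in>permutations_of_set (V - {y}). t ^ steps \<epsilon> x (y # ys))
        = (\<Sum>ys\<in>permutations_of_set (V - {y}).
            if ?hit y then t * t ^ steps \<epsilon> y ys else t ^ steps \<epsilon> x ys)"
      by (rule sum.cong) (simp_all add: len[OF y])
    also have "\<dots> = (if ?hit y then t * (\<Sum>ys\<in>permutations_of_set (V - {y}). t ^ steps \<epsilon> y ys)
        else (\<Sum>ys\<in>permutations_of_set (V - {y}). t ^ steps \<epsilon> x ys))"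
      by (simp add: sum_distrib_left)
    also have "\<dots> = (if ?hit y then t * ?W (?rank y) else ?W (card {v \<in> V - {y}. v < x}))"
      using Suc.IH[of "V - {y}" y] Suc.IH[of "V - {y}" x] Suc.prems card_del[OF y] same by simp
    finally show "(\<Sum>ys\<in>permutations_of_set (V - {y}). t ^ steps \<epsilon> x (y # ys)) = \<dots>" .
  qed
  also have "\<dots> = walk_sum t \<epsilon> (Suc k) (Suc k) (?rank x)"
  proof -
    have above: "card {v \<in> V - {y}. v < x} = ?rank x" if "x < y" for y
      using that by (intro arg_cong[of _ _ card]) auto
    have below: "card {v \<in> V - {y}. v < x} = ?rank x - 1" if "y \<in> V" "y < x" for y
    proof -
      have "{v \<in> V - {y}. v < x} = {v \<in> V. v < x} - {y}" by auto
      then show ?thesis using that Suc.prems by simp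
    qed
    have split: "(\<Sum>y\<in>V. h y) = (\<Sum>y | y \<in> V \<and> y < x. h y) + (\<Sum>y | y \<in> V \<and> x < y. h y)"
      for h :: "nat \<Rightarrow> nat"
    proof -
      have V: "V = {y. y \<in> V \<and> y < x} \<union> {y. y \<in> V \<and> x < y}"
        using Suc.prems(3) by (auto simp: not_less_iff_gr_or_eq)
      show ?thesis
        by (subst V, rule sum.union_disjoint) (use Suc.prems in auto)
    qed
    have upper: "card {y. y \<in> V \<and> x < y} = Suc k - ?rank x"
    proof -
      have "Suc k = ?rank x + card {y. y \<in> V \<and> x < y}"
        using split[of "\<lambda>_. 1"] Suc.prems by simp
      then show ?thesis by simp
    qed
    note ranks = sum_over_ranks_above[OF Suc.prems(1,3), of ?W]
      sum_over_ranks_below[OF Suc.prems(1,3), of ?W]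
    show ?thesis
    proof (cases "\<epsilon> (Suc k)")
      case Plus
      have "(\<Sum>y\<in>V. if ?hit y then t * ?W (?rank y) else ?W (card {v \<in> V - {y}. v < x}))
          = (\<Sum>y | y \<in> V \<and> y < x. ?W (?rank x - 1))
            + (\<Sum>y | y \<in> V \<and> x < y. t * ?W (?rank y))"
        unfolding split
        by (intro arg_cong2[of _ _ _ _ "(+)"] sum.cong) (auto simp: on_side_def Plus below simp del: Diff_iff)
      then show ?thesis
        using ranks Suc.prems by (simp add: Plus flip: sum_distrib_left)
    next
      case Minus
      have "(\<Sum>y\<in>V. if ?hit y then t * ?W (?rank y) else ?W (card {v \<in> V - {y}. v < x}))
          = (\<Sum>y | y \<in> V \<and> y < x. t * ?W (?rank y))
            + (\<Sum>y | y \<in> V \<and> x < y. ?W (?rank x))"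
        unfolding split
        by (intro arg_cong2[of _ _ _ _ "(+)"] sum.cong) (auto simp: on_side_def Minus above simp del: Diff_iff)
      then show ?thesis
        using ranks Suc.prems by (simp add: Minus upper flip: sum_distrib_left)
    qed
  qed
  finally show ?case .
qed

lemma sum_permutes_rec_count:
  "(\<Sum>\<pi> | \<pi> permutes {1..Suc k}. t ^ rec_count (Suc k) \<epsilon> \<pi>)
    = t * (\<Sum>a<Suc k. walk_sum t \<epsilon> k k a)"
proof -
  let ?V = "{1..Suc k}"
  have "(\<Sum>\<pi> | \<pi> permutes ?V. t ^ rec_count (Suc k) \<epsilon> \<pi>)
      = (\<Sum>\<pi> | \<pi> permutes ?V. case down_word \<pi> (Suc k) of y # ys \<Rightarrow> t ^ Suc (steps \<epsilon> y ys))"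
    by (simp add: rec_count_eq_steps)
  also have "\<dots> = (\<Sum>xs\<in>permutations_of_set ?V. case xs of y # ys \<Rightarrow> t ^ Suc (steps \<epsilon> y ys))"
    by (rule sum.reindex_bij_betw[OF bij_betw_down_word])
  also have "\<dots> = (\<Sum>y\<in>?V. \<Sum>ys\<in>permutations_of_set (?V - {y}). t ^ Suc (steps \<epsilon> y ys))"
    by (subst sum_permutations_of_set_first) auto
  also have "\<dots> = (\<Sum>y\<in>?V. t * walk_sum t \<epsilon> k k (card {v \<in> ?V. v < y}))"
  proof (rule sum.cong[OF refl])
    fix y assume y: "y \<in> ?V"
    have "{v \<in> ?V - {y}. v < y} = {v \<in> ?V. v < y}" by auto
    then show "(\<Sum>ys\<in>permutations_of_set (?V - {y}). t ^ Suc (steps \<epsilon> y ys))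
        = t * walk_sum t \<epsilon> k k (card {v \<in> ?V. v < y})"
      using walk_sum_counts_words[of "?V - {y}" k y t \<epsilon>] y by (simp flip: sum_distrib_left)
  qed
  also have "\<dots> = t * (\<Sum>a<Suc k. walk_sum t \<epsilon> k k a)"
    using sum_over_ranks[of ?V "walk_sum t \<epsilon> k k"] by (simp flip: sum_distrib_left)
  finally show ?thesis .
qed

section \<open>Degree elevation\<close>

text \<open>
  If \<open>c\<close> is the sequence of coefficients of a polynomial in the basis
  \<open>x\<^sup>a (1 - x)\<^sup>N\<^sup>-\<^sup>a / (a! (N - a)!)\<close>, then \<open>elevate N c\<close> is its sequence of coefficients in the same
  basis for \<open>N + 1\<close>, as one sees on multiplying by \<open>x + (1 - x)\<close>. For words it is the effect of one more
  position that the walk never looks at: the letter there is one of \<open>a\<close> smaller or \<open>N + 1 - a\<close>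
  larger ones. The difference \<open>a - 1\<close> at \<open>a = 0\<close> is harmless, being multiplied by \<open>0\<close>.
\<close>

definition elevate :: "nat \<Rightarrow> (nat \<Rightarrow> nat) \<Rightarrow> nat \<Rightarrow> nat" where
  "elevate N c a = a * c (a - 1) + (Suc N - a) * c a"

lemma elevate_linear:
  "elevate N (\<lambda>b. f b + t * g b) a = elevate N f a + t * elevate N g a"
  by (simp add: elevate_def algebra_simps)

text \<open>
  The equations are triangular: the one at \<open>a\<close> determines \<open>c a\<close> from \<open>c (a - 1)\<close>, because
  the factor \<open>N + 1 - a\<close> is positive.
\<close>

lemma elevate_inj:
  assumes "\<And>b. b \<le> Suc N \<Longrightarrow> elevate N c b = elevate N d b" "a \<le> N"
  shows "c a = d a"
  using assms(2)
proof (induction a)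
  case 0
  then show ?case using assms(1)[of 0] by (simp add: elevate_def del: mult_Suc)
next
  case (Suc a)
  then show ?case using assms(1)[of "Suc a"] by (simp add: elevate_def)
qed

text \<open>
  The next four lemmas say that elevation commutes with the operations that occur in the
  recursion of \<open>walk_sum\<close>. For polynomials these operations are multiplication by \<open>x\<close> and by \<open>1 - x\<close>
  and integration from \<open>0\<close> to \<open>x\<close> and from \<open>x\<close> to \<open>1\<close>, each of which raises the degree by one.
\<close>

lemma elevate_mult_left:
  "a * elevate N c (a - 1) = elevate (Suc N) (\<lambda>b. b * c (b - 1)) a"
proof (cases a)
  case (Suc b)
  show ?thesis
    unfolding Suc elevate_def diff_Suc_Suc diff_Suc_1 add_mult_distrib2 by (simp only: mult.left_commute)
qed (simp add: elevate_def)

lemma elevate_mult_right: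
  "(Suc (Suc N) - a) * elevate N c a = elevate (Suc N) (\<lambda>b. (Suc N - b) * c b) a"
proof (cases a)
  case (Suc b)
  show ?thesis
    unfolding Suc elevate_def diff_Suc_Suc diff_Suc_1 add_mult_distrib2 by (simp only: mult.left_commute)
qed (simp add: elevate_def)

lemma elevate_sum_below:
  assumes "a \<le> Suc (Suc N)"
  shows "(\<Sum>s<a. elevate N c s) = elevate (Suc N) (\<lambda>b. \<Sum>s<b. c s) a"
  using assms
proof (induction a)
  case 0
  then show ?case by (simp add: elevate_def)
next
  case (Suc a)
  then obtain d where N: "Suc N = a + d" using less_eqE by auto
  show ?case
  proof (cases a)
    case 0
    then show ?thesis by (simp add: elevate_def)
  next
    case (Suc b)
    then show ?thesis using Suc.IH Suc.prems N by (simp add: elevate_def algebra_simps)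
  qed
qed

lemma elevate_sum_above:
  assumes "a \<le> Suc (Suc N)"
  shows "(\<Sum>s=a..<Suc (Suc N). elevate N c s) = elevate (Suc N) (\<lambda>b. \<Sum>s=b..<Suc N. c s) a"
  using assms
proof (induction a rule: inc_induct)
  case base
  then show ?case by (simp add: elevate_def)
next
  case (step a)
  obtain d where N: "Suc N = a + d" using step.hyps less_eqE[of a "Suc N"] by auto
  define T where "T b = (\<Sum>s=b..<Suc N. c s)" for b
  have T: "T b = c b + T (Suc b)" if "b \<le> N" for b
    unfolding T_def by (rule sum.atLeast_Suc_lessThan) (use that in simp)
  have "(\<Sum>s=a..<Suc (Suc N). elevate N c s)
      = elevate N c a + (\<Sum>s=Suc a..<Suc (Suc N). elevate N c s)"
    by (rule sum.atLeast_Suc_lessThan) (use step.hyps in simp)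
  also have "\<dots> = elevate N c a + elevate (Suc N) T (Suc a)"
    unfolding T_def step.IH ..
  also have "\<dots> = elevate (Suc N) T a"
  proof (cases a)
    case 0
    then show ?thesis using T[of 0] by (simp add: elevate_def algebra_simps)
  next
    case (Suc b)
    then have b: "T b = c b + T a" using T[of b] step.hyps by simp
    \<comment> \<open>The factor \<open>d = N + 1 - a\<close> vanishes at \<open>a = N + 1\<close>, where \<open>c a\<close> does not contribute to \<open>T a\<close>.\<close>
    have a: "d * T a = d * c a + d * T (Suc a)"
      using T[of a] N by (cases d) (simp_all add: algebra_simps)
    have "elevate N c a + elevate (Suc N) T (Suc a) = a * (c b + T a) + T a + (d * c a + d * T (Suc a))"
      using Suc N by (simp add: elevate_def algebra_simps)
    also have "\<dots> = a * T b + Suc d * T a"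
      unfolding a[symmetric] b by simp
    finally show ?thesis using Suc N by (simp add: elevate_def)
  qed
  finally show ?case unfolding T_def .
qed

lemma sum_elevate: "(\<Sum>a<Suc (Suc N). elevate N c a) = Suc (Suc N) * (\<Sum>a<Suc N. c a)"
  using elevate_sum_below[of "Suc (Suc N)" N c] by (simp add: elevate_def)

text \<open>
  For \<open>k = 0\<close> both sides are \<open>(N + 1)!\<close>, and the recursion step commutes with elevation.
\<close>

lemma walk_sum_elevate:
  assumes "k \<le> N" "a \<le> Suc N"
  shows "walk_sum t \<epsilon> k (Suc N) a = elevate N (walk_sum t \<epsilon> k N) a"
  using assms
proof (induction k arbitrary: N a)
  case 0
  have "a * fact N + (Suc N - a) * fact N = Suc N * (fact N :: nat)"
    using 0 by (metis add_mult_distrib le_add_diff_inverse)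
  then show ?case by (simp add: elevate_def)
next
  case (Suc k)
  then obtain M where N: "N = Suc M" by (cases N) auto
  let ?c = "walk_sum t \<epsilon> k M"
  have IH: "walk_sum t \<epsilon> k N b = elevate M ?c b" if "b \<le> N" for b
    using Suc.IH[of M b] Suc.prems that N by simp
  show ?case
  proof (cases "\<epsilon> (Suc k)")
    case Plus
    have "walk_sum t \<epsilon> (Suc k) (Suc N) a
        = a * elevate M ?c (a - 1) + t * (\<Sum>s=a..<Suc (Suc M). elevate M ?c s)"
      using Plus IH Suc.prems N by simp
    also have "\<dots> = elevate N (\<lambda>b. b * ?c (b - 1) + t * (\<Sum>s=b..<N. ?c s)) a"
      using Suc.prems unfolding N
      by (simp only: elevate_mult_left elevate_sum_above elevate_linear)
    also have "\<dots> = elevate N (walk_sum t \<epsilon> (Suc k) N) a"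
      using Plus N by (simp add: elevate_def)
    finally show ?thesis .
  next
    case Minus
    have "walk_sum t \<epsilon> (Suc k) (Suc N) a
        = (Suc (Suc M) - a) * elevate M ?c a + t * (\<Sum>s<a. elevate M ?c s)"
      using Minus IH Suc.prems N by (cases "a = Suc N") simp_all
    also have "\<dots> = elevate N (\<lambda>b. (N - b) * ?c b + t * (\<Sum>s<b. ?c s)) a"
      using Suc.prems unfolding N
      by (simp only: elevate_mult_right elevate_sum_below elevate_linear)
    also have "\<dots> = elevate N (walk_sum t \<epsilon> (Suc k) N) a"
      using Minus N by (simp add: elevate_def)
    finally show ?thesis .
  qed
qed

text \<open>
  Both sides compute the same integral over \<open>[0,1]\<close>, in degrees \<open>N\<close> and \<open>k\<close>: each basis
  element of degree \<open>N\<close> has integral \<open>1 / (N + 1)!\<close>.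
\<close>

lemma sum_walk_sum:
  assumes "k \<le> N"
  shows "fact (Suc k) * (\<Sum>a<Suc N. walk_sum t \<epsilon> k N a)
    = fact (Suc N) * (\<Sum>a<Suc k. walk_sum t \<epsilon> k k a)"
  using assms
proof (induction N rule: dec_induct)
  case base
  then show ?case by simp
next
  case (step N)
  have "(\<Sum>a<Suc (Suc N). walk_sum t \<epsilon> k (Suc N) a)
      = (\<Sum>a<Suc (Suc N). elevate N (walk_sum t \<epsilon> k N) a)"
    using step.hyps by (intro sum.cong walk_sum_elevate) auto
  also have "\<dots> = Suc (Suc N) * (\<Sum>a<Suc N. walk_sum t \<epsilon> k N a)"
    by (rule sum_elevate)
  finally have "fact (Suc k) * (\<Sum>a<Suc (Suc N). walk_sum t \<epsilon> k (Suc N) a)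
      = Suc (Suc N) * (fact (Suc k) * (\<Sum>a<Suc N. walk_sum t \<epsilon> k N a))"
    by (simp only: mult.left_commute)
  then show ?case using step.IH by (simp only: fact_Suc[of "Suc N"] of_nat_id mult.assoc)
qed

section \<open>The fence recursion\<close>

text \<open>
  The number of ways to fill \<open>x\<^sub>1, \<dots>, x\<^sub>k\<close> with values in \<open>{0..N}\<close> when \<open>x\<^sub>k\<^sub>+\<^sub>1\<close> has the value
  \<open>a\<close> and all relations among \<open>x\<^sub>1, \<dots>, x\<^sub>k\<^sub>+\<^sub>1\<close> are respected.
\<close>

primrec fence_count :: "nat \<Rightarrow> (nat \<Rightarrow> plusminus) \<Rightarrow> nat \<Rightarrow> nat \<Rightarrow> nat" where
  "fence_count N \<epsilon> 0 a = 1"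
| "fence_count N \<epsilon> (Suc k) a =
     (case \<epsilon> (Suc k) of
       Plus \<Rightarrow> (\<Sum>b=a..<Suc N. fence_count N \<epsilon> k b)
     | Minus \<Rightarrow> (\<Sum>b\<le>a. fence_count N \<epsilon> k b))"

text \<open>
  With \<open>t = N + 1\<close>, the recursion step for \<open>walk_sum\<close>, which goes from degree \<open>N\<close> to \<open>N + 1\<close>, is
  the recursion step for \<open>fence_count\<close>, which stays in degree \<open>N\<close>, followed by elevation. This is
  where the value of \<open>t\<close> and the number of values of the maps have to match.
\<close>

lemma elevate_upper_sum:
  assumes "a \<le> Suc N"
  shows "elevate N (\<lambda>a. \<Sum>b=a..<Suc N. h b) a = a * h (a - 1) + Suc N * (\<Sum>b=a..<Suc N. h b)"
proof (cases a)
  case (Suc a')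
  then obtain d where "N = a' + d" using assms less_eqE by auto
  then show ?thesis
    using Suc by (simp add: elevate_def sum.atLeast_Suc_lessThan[of a'] algebra_simps)
qed (simp add: elevate_def)

lemma elevate_lower_sum:
  assumes "a \<le> Suc N"
  shows "elevate N (\<lambda>a. \<Sum>b\<le>a. h b) a = (Suc N - a) * h a + Suc N * (\<Sum>b<a. h b)"
proof (cases a)
  case (Suc a')
  then obtain d where "N = a' + d" using assms less_eqE by auto
  then show ?thesis
    using Suc by (simp add: elevate_def lessThan_Suc_atMost algebra_simps)
qed (simp add: elevate_def)

text \<open>
  The step from \<open>k\<close> to \<open>k + 1\<close> is first proved after elevation to degree \<open>N + 1\<close>, where the
  recursion for \<open>walk_sum\<close> refers back to degree \<open>N\<close>, and then the elevation is cancelled.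
\<close>

lemma walk_sum_eq_fence_count:
  assumes "k \<le> N" "a \<le> N"
  shows "walk_sum (Suc N) \<epsilon> k N a = fact N * fence_count N \<epsilon> k a"
  using assms
proof (induction k arbitrary: a)
  case 0
  then show ?case by simp
next
  case (Suc k)
  have IH: "walk_sum (Suc N) \<epsilon> k N b = fact N * fence_count N \<epsilon> k b" if "b \<le> N" for b
    using Suc that by simp
  have "elevate N (walk_sum (Suc N) \<epsilon> (Suc k) N) b
      = elevate N (\<lambda>a. fact N * fence_count N \<epsilon> (Suc k) a) b" if b: "b \<le> Suc N" for b
  proof -
    have scale: "elevate N (\<lambda>a. fact N * f a) b = fact N * elevate N f b" for f
      by (simp add: elevate_def algebra_simps)
    have "elevate N (walk_sum (Suc N) \<epsilon> (Suc k) N) b = walk_sum (Suc N) \<epsilon> (Suc k) (Suc N) b"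
      using walk_sum_elevate[OF Suc.prems(1) b] by simp
    also have "\<dots> = fact N * elevate N (fence_count N \<epsilon> (Suc k)) b"
    proof (cases "\<epsilon> (Suc k)")
      case Plus
      have "walk_sum (Suc N) \<epsilon> (Suc k) (Suc N) b
          = b * (fact N * fence_count N \<epsilon> k (b - 1))
            + Suc N * (\<Sum>s=b..<Suc N. fact N * fence_count N \<epsilon> k s)"
        using Plus b IH by simp
      also have "\<dots> = fact N * elevate N (\<lambda>a. \<Sum>s=a..<Suc N. fence_count N \<epsilon> k s) b"
        unfolding elevate_upper_sum[OF b] by (simp only: sum_distrib_left[symmetric]) algebra
      also have "(\<lambda>a. \<Sum>s=a..<Suc N. fence_count N \<epsilon> k s) = fence_count N \<epsilon> (Suc k)"
        using Plus by (simp add: fun_eq_iff)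
      finally show ?thesis .
    next
      case Minus
      have "walk_sum (Suc N) \<epsilon> (Suc k) (Suc N) b
          = (Suc N - b) * (fact N * fence_count N \<epsilon> k b)
            + Suc N * (\<Sum>s<b. fact N * fence_count N \<epsilon> k s)"
        using Minus b IH by (cases "b = Suc N") simp_all
      also have "\<dots> = fact N * elevate N (\<lambda>a. \<Sum>s\<le>a. fence_count N \<epsilon> k s) b"
        unfolding elevate_lower_sum[OF b] by (simp only: sum_distrib_left[symmetric]) algebra
      also have "(\<lambda>a. \<Sum>s\<le>a. fence_count N \<epsilon> k s) = fence_count N \<epsilon> (Suc k)"
        using Minus by (simp add: fun_eq_iff)
      finally show ?thesis .
    qed
    finally show ?thesis by (simp only: scale)
  qed
  then show ?case using Suc.prems(2) by (rule elevate_inj)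
qed

text \<open>
  Values are shifted by one because ranks start at \<open>0\<close> and maps into \<open>[N + 1]\<close> start at \<open>1\<close>.
\<close>

definition fence_fillings :: "nat \<Rightarrow> (nat \<Rightarrow> plusminus) \<Rightarrow> nat \<Rightarrow> nat \<Rightarrow> (nat \<Rightarrow> nat) set" where
  "fence_fillings N \<epsilon> k a = {f \<in> {1..Suc k} \<rightarrow>\<^sub>E {1..Suc N}. f (Suc k) = Suc a \<and>
     (\<forall>i\<in>{1..k}. f i = f (Suc i) \<or> on_side (\<epsilon> i) (f i) (f (Suc i)))}"

lemma finite_fence_fillings: "finite (fence_fillings N \<epsilon> k a)"
  by (rule finite_subset[of _ "{1..Suc k} \<rightarrow>\<^sub>E {1..Suc N}"])
    (auto simp: fence_fillings_def intro: finite_PiE)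

lemma disjoint_fence_fillings:
  "a \<noteq> b \<Longrightarrow> fence_fillings N \<epsilon> k a \<inter> fence_fillings N \<epsilon> k b = {}"
  by (auto simp: fence_fillings_def)

lemma card_fence_fillings:
  assumes "a \<le> N"
  shows "card (fence_fillings N \<epsilon> k a) = fence_count N \<epsilon> k a"
  using assms
proof (induction k arbitrary: a)
  case 0
  have "fence_fillings N \<epsilon> 0 a = {\<lambda>i. if i = 1 then Suc a else undefined}"
    using 0 by (auto simp: fence_fillings_def PiE_iff extensional_def fun_eq_iff)
  then show ?case by simp
next
  case (Suc k)
  define B where "B = {b. b \<le> N \<and> (b = a \<or> on_side (\<epsilon> (Suc k)) b a)}"
  have step: "bij_betw (\<lambda>f. f(Suc (Suc k) := Suc a)) (\<Union>b\<in>B. fence_fillings N \<epsilon> k b)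
      (fence_fillings N \<epsilon> (Suc k) a)"
    \<comment> \<open>Maps are extensional, so restricting to \<open>{1..Suc k}\<close> resets the last value to \<open>undefined\<close>.\<close>
  proof (rule bij_betwI[where g = "\<lambda>f. f(Suc (Suc k) := undefined)"])
    show "(\<lambda>f. f(Suc (Suc k) := Suc a))
        \<in> (\<Union>b\<in>B. fence_fillings N \<epsilon> k b) \<rightarrow> fence_fillings N \<epsilon> (Suc k) a"
    proof
      fix f assume "f \<in> (\<Union>b\<in>B. fence_fillings N \<epsilon> k b)"
      then obtain b where "b \<in> B" and f: "f \<in> fence_fillings N \<epsilon> k b" by blast
      then have "f (Suc k) = Suc a \<or> on_side (\<epsilon> (Suc k)) (f (Suc k)) (Suc a)"
        by (auto simp: B_def fence_fillings_def on_side_def split: plusminus.split)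
      then have "\<forall>i\<in>{1..Suc k}. (f(Suc (Suc k) := Suc a)) i = (f(Suc (Suc k) := Suc a)) (Suc i)
          \<or> on_side (\<epsilon> i) ((f(Suc (Suc k) := Suc a)) i) ((f(Suc (Suc k) := Suc a)) (Suc i))"
        using f by (auto simp: fence_fillings_def le_Suc_eq)
      moreover have "f(Suc (Suc k) := Suc a) \<in> insert (Suc (Suc k)) {1..Suc k} \<rightarrow>\<^sub>E {1..Suc N}"
        by (rule PiE_fun_upd) (use f Suc.prems in \<open>auto simp: fence_fillings_def\<close>)
      then have "f(Suc (Suc k) := Suc a) \<in> {1..Suc (Suc k)} \<rightarrow>\<^sub>E {1..Suc N}"
        by (simp only: atLeastAtMostSuc_conv[of 1 "Suc k"] le_add1 plus_1_eq_Suc)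
      ultimately show "f(Suc (Suc k) := Suc a) \<in> fence_fillings N \<epsilon> (Suc k) a"
        unfolding fence_fillings_def by simp
    qed
    show "(\<lambda>f. f(Suc (Suc k) := undefined))
        \<in> fence_fillings N \<epsilon> (Suc k) a \<rightarrow> (\<Union>b\<in>B. fence_fillings N \<epsilon> k b)"
    proof
      fix f assume f: "f \<in> fence_fillings N \<epsilon> (Suc k) a"
      then have "f (Suc k) \<in> {1..Suc N}" by (auto simp: fence_fillings_def PiE_iff)
      then obtain b where b: "f (Suc k) = Suc b" "b \<le> N" by (cases "f (Suc k)") auto
      have last: "f (Suc (Suc k)) = Suc a"
          "f (Suc k) = f (Suc (Suc k)) \<or> on_side (\<epsilon> (Suc k)) (f (Suc k)) (f (Suc (Suc k)))"
        using f by (force simp: fence_fillings_def)+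
      have "b \<in> B"
        using last b by (auto simp: B_def on_side_def split: plusminus.splits)
      moreover have "f(Suc (Suc k) := undefined) \<in> fence_fillings N \<epsilon> k b"
        using f b(1) by (auto simp: fence_fillings_def PiE_iff extensional_def)
      ultimately show "f(Suc (Suc k) := undefined) \<in> (\<Union>b\<in>B. fence_fillings N \<epsilon> k b)" by blast
    qed
  qed (auto simp: fence_fillings_def PiE_iff extensional_def fun_eq_iff)
  have "card (fence_fillings N \<epsilon> (Suc k) a) = card (\<Union>b\<in>B. fence_fillings N \<epsilon> k b)"
    using bij_betw_same_card[OF step] by simp
  also have "\<dots> = (\<Sum>b\<in>B. card (fence_fillings N \<epsilon> k b))"
    by (rule card_UN_disjoint) (auto simp: finite_fence_fillings disjoint_fence_fillings B_def)
  also have "\<dots> = (\<Sum>b\<in>B. fence_count N \<epsilon> k b)"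
    by (rule sum.cong) (auto simp: B_def Suc.IH)
  also have "\<dots> = fence_count N \<epsilon> (Suc k) a"
  proof (cases "\<epsilon> (Suc k)")
    case Plus
    then have "B = {a..<Suc N}" using Suc.prems by (auto simp: B_def on_side_def)
    then show ?thesis using Plus by simp
  next
    case Minus
    then have "B = {..a}" using Suc.prems by (auto simp: B_def on_side_def)
    then show ?thesis using Minus by simp
  qed
  finally show ?case .
qed

lemma monotone_along_trancl:
  fixes f :: "'a \<Rightarrow> 'b::preorder"
  assumes "(a, b) \<in> r\<^sup>+" and "\<And>a b. (a, b) \<in> r \<Longrightarrow> f a \<le> f b"
  shows "f a \<le> f b"
  using assms(1) by (induction rule: trancl_induct) (auto intro: assms(2) order_trans)

text \<open>
  A map is monotone for the transitive closure as soon as it is monotone along the generating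
  relations, and those only compare neighbours.
\<close>

lemma order_preserving_maps_fence:
  "order_preserving_maps {1..Suc k} (fence (Suc k) \<epsilon>) (Suc N)
    = (\<Union>a<Suc N. fence_fillings N \<epsilon> k a)"
proof (rule set_eqI)
  fix f :: "nat \<Rightarrow> nat"
  let ?step = "fence_step (Suc k) \<epsilon>"
  have "(\<forall>a\<in>{1..Suc k}. \<forall>b\<in>{1..Suc k}. (a, b) \<in> fence (Suc k) \<epsilon> \<longrightarrow> f a \<le> f b)
      \<longleftrightarrow> (\<forall>a b. (a, b) \<in> ?step \<longrightarrow> f a \<le> f b)" (is "?mono \<longleftrightarrow> ?local")
  proof
    assume ?mono
    show ?local
    proof (intro allI impI)
      fix a b assume ab: "(a, b) \<in> ?step"
      then have "a \<in> {1..Suc k}" "b \<in> {1..Suc k}" by (auto simp: fence_step_def)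
      moreover have "(a, b) \<in> fence (Suc k) \<epsilon>" using ab by (simp add: fence_def r_into_trancl)
      ultimately show "f a \<le> f b" using \<open>?mono\<close> by blast
    qed
  next
    assume local: ?local
    have "f a \<le> f b" if "(a, b) \<in> fence (Suc k) \<epsilon>" for a b
      using that unfolding fence_def
    proof
      assume "(a, b) \<in> ?step\<^sup>+"
      then show "f a \<le> f b" by (rule monotone_along_trancl) (use local in blast)
    qed auto
    then show ?mono by blast
  qed
  also have "\<dots> \<longleftrightarrow> (\<forall>i\<in>{1..k}. (\<epsilon> i = Plus \<longrightarrow> f (Suc i) \<le> f i) \<and> (\<epsilon> i = Minus \<longrightarrow> f i \<le> f (Suc i)))"
    unfolding fence_step_def by auto
  also have "\<dots> \<longleftrightarrow> (\<forall>i\<in>{1..k}. f i = f (Suc i) \<or> on_side (\<epsilon> i) (f i) (f (Suc i)))"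
    by (intro ball_cong refl) (auto simp: on_side_def split: plusminus.split)
  finally have mono: "?mono \<longleftrightarrow> \<dots>" .
  show "f \<in> order_preserving_maps {1..Suc k} (fence (Suc k) \<epsilon>) (Suc N)
      \<longleftrightarrow> f \<in> (\<Union>a<Suc N. fence_fillings N \<epsilon> k a)"
  proof (cases "f \<in> {1..Suc k} \<rightarrow>\<^sub>E {1..Suc N}")
    case True
    then have "f (Suc k) \<in> {1..Suc N}" by auto
    then have "\<exists>a<Suc N. f (Suc k) = Suc a" by (cases "f (Suc k)") auto
    then show ?thesis using True mono by (auto simp: order_preserving_maps_def fence_fillings_def)
  qed (auto simp: order_preserving_maps_def fence_fillings_def)
qed

lemma card_order_preserving_maps_fence:
  "card (order_preserving_maps {1..Suc k} (fence (Suc k) \<epsilon>) (Suc N))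
    = (\<Sum>a<Suc N. fence_count N \<epsilon> k a)"
proof -
  have "card (\<Union>a<Suc N. fence_fillings N \<epsilon> k a) = (\<Sum>a<Suc N. card (fence_fillings N \<epsilon> k a))"
    by (rule card_UN_disjoint) (auto simp: finite_fence_fillings disjoint_fence_fillings)
  then show ?thesis
    unfolding order_preserving_maps_fence by (simp add: card_fence_fillings)
qed

section \<open>Comparison\<close>

text \<open>
  This is the theorem at \<open>t = N + 1\<close>. The bound \<open>k \<le> N\<close> is needed because elevation can
  only raise the degree from \<open>k\<close> to \<open>N\<close>.
\<close>

lemma sum_rec_count_eq_card_maps:
  assumes "k \<le> N"
  shows "(\<Sum>\<pi> | \<pi> permutes {1..Suc k}. Suc N ^ rec_count (Suc k) \<epsilon> \<pi>)
    = fact (Suc k) * card (order_preserving_maps {1..Suc k} (fence (Suc k) \<epsilon>) (Suc N))"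
    (is "?L = fact (Suc k) * ?R")
proof -
  have "fact N * (fact (Suc k) * ?R)
      = fact (Suc k) * (\<Sum>a<Suc N. walk_sum (Suc N) \<epsilon> k N a)"
    unfolding card_order_preserving_maps_fence
    using assms
    by (simp add: walk_sum_eq_fence_count sum_distrib_left mult.left_commute del: sum.lessThan_Suc fact_Suc)
  also have "\<dots> = fact (Suc N) * (\<Sum>a<Suc k. walk_sum (Suc N) \<epsilon> k k a)"
    by (rule sum_walk_sum[OF assms])
  also have "\<dots> = fact N * ?L"
    unfolding sum_permutes_rec_count by (simp only: fact_Suc of_nat_id mult_ac)
  finally show ?thesis by simp
qed

lemma poly_eqI_of_nat_greater:
  fixes p q :: "'a::{idom, ring_char_0} poly"
  assumes "\<And>m. m > k \<Longrightarrow> poly p (of_nat m) = poly q (of_nat m)"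
  shows "p = q"
proof (rule ccontr)
  assume "p \<noteq> q"
  then have "finite {x. poly (p - q) x = 0}" by (intro poly_roots_finite) auto
  moreover have "of_nat ` {k<..} \<subseteq> {x. poly (p - q) x = (0 :: 'a)}" using assms by auto
  ultimately have "finite ((of_nat :: nat \<Rightarrow> 'a) ` {k<..})" by (rule finite_subset[rotated])
  then have "finite {k<..}" by (rule finite_imageD) (auto simp: inj_on_def)
  then show False using infinite_Ioi by blast
qed

theorem theorem1p1:
  fixes n :: nat and \<epsilon> :: "nat \<Rightarrow> plusminus"
  assumes "n \<ge> 1"
  shows "(\<Sum>\<pi> | \<pi> permutes {1..n}. monom 1 (rec_count n \<epsilon> \<pi>)) =
         smult (fact n) (order_polynomial {1..n} (fence n \<epsilon>))"
proof (rule poly_eqI_of_nat_greater[of "n - 1"])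
  fix m assume m: "m > n - 1"
  obtain k N where n: "n = Suc k" and N: "m = Suc N" "k \<le> N"
    using assms m by (cases n; cases m) auto
  have "poly (\<Sum>\<pi> | \<pi> permutes {1..n}. monom 1 (rec_count n \<epsilon> \<pi>)) (of_nat m)
      = (of_nat (\<Sum>\<pi> | \<pi> permutes {1..n}. m ^ rec_count n \<epsilon> \<pi>) :: rat)"
    by (simp add: poly_sum poly_monom)
  also have "\<dots> = of_nat (fact n * card (order_preserving_maps {1..n} (fence n \<epsilon>) m))"
    unfolding n N(1) sum_rec_count_eq_card_maps[OF N(2)] ..
  also have "\<dots> = poly (smult (fact n) (order_polynomial {1..n} (fence n \<epsilon>))) (of_nat m)"
    using m by (simp add: poly_order_polynomial)
  finally show "poly (\<Sum>\<pi> | \<pi> permutes {1..n}. monom 1 (rec_count n \<epsilon> \<pi>)) (of_nat m)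
      = poly (smult (fact n) (order_polynomial {1..n} (fence n \<epsilon>))) (of_nat m)" .
qed

end
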